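(* There exist a badly approximable irrational $\alpha\in(0,1)$, with associated rotation $R:[0,1)\to[0,1)$, $R(x)=x+\alpha \bmod 1$, and a function $f:[0,1)\to\mathbb{Z}$ with $\int_0^1 f\,dx=0$ such that $f$ is the difference of the characteristic functions of two intervals and, for Lebesgue almost every $x\in[0,1)$, $$\liminf_{N\to\infty}\sum_{i=0}^{N} f(R^i x)>-\infty\quad\text{while}\quad \limsup_{N\to\infty}\sum_{i=0}^{N} f(R^i x)=+\infty .$$
   Context: An irrational $\alpha$ is badly approximable if $\liminf_{n\to\infty} n\, d(n\alpha,\mathbb{Z})>0$, where $d(\cdot,\mathbb{Z})$ is the distance to the nearest integer. *)

theory Defs
  imports "HOL-Analysis.Analysis"
begin

definition badly_approximable :: "real \<Rightarrow> bool" where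
  "badly_approximable \<alpha> \<longleftrightarrow>
     \<alpha> \<notin> \<rat> \<and> liminf (\<lambda>n. ereal (real n * infdist (real n * \<alpha>) \<int>)) > 0"

definition rotation :: "real \<Rightarrow> real \<Rightarrow> real" where
  "rotation \<alpha> x = frac (x + \<alpha>)"

end

theory Submission
  imports Defs
begin

text \<open>
  Let \<open>\<alpha>\<close> be the golden rotation number and take \<open>f = 1[0, \<beta>) - 1[c, c + \<beta>)\<close> on the circle, where
  \<open>\<beta> = e 0 + e 1 + \<dots>\<close> and \<open>c = d 0 + d 1 + \<dots>\<close> for rapidly decreasing, interleaved sequences with
  \<open>e j \<equiv> a j * \<alpha>\<close> and \<open>d k \<equiv> b k * \<alpha>\<close> mod 1, all multipliers \<open>a j\<close>, \<open>b k\<close> and all errors \<open>e j\<close>,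
  \<open>d k\<close> being positive. Shifting an arc by \<open>d k\<close> changes its indicator by a coboundary whose
  transfer function is a sum of \<open>b k\<close> rotated copies of \<open>1[0, \<beta>)\<close>. Positivity of the errors makes
  this sum a constant plus a nonnegative integer-valued \<open>t k\<close>, and \<open>t k\<close> is supported on a set of
  summably small measure. Hence \<open>f\<close> is the limit of coboundaries of an increasing sequence
  \<open>H k \<ge> 0\<close> that is bounded at almost every point (Borel-Cantelli) but exceeds any given bound on
  some interval. The Birkhoff sums are \<open>H (x + N \<alpha>) - H (x - \<alpha>)\<close>: bounded below since \<open>H \<ge> 0\<close>,
  unbounded above since the orbit is dense.
\<close>

section \<open>The golden rotation number is badly approximable\<close>

definition golden :: real where "golden = (sqrt 5 - 1) / 2"

lemma golden_sq: "golden * golden = 1 - golden"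
  unfolding golden_def by (simp add: field_simps)

lemma golden_bounds: "3 / 5 < golden" "golden < 5 / 8"
proof -
  have "11 / 5 < sqrt 5" by (rule real_less_rsqrt) (simp add: power2_eq_square)
  moreover have "sqrt 5 < 9 / 4" by (rule real_less_lsqrt) (simp_all add: power2_eq_square)
  ultimately show "3 / 5 < golden" "golden < 5 / 8" unfolding golden_def by simp_all
qed

lemma golden_irrational: "golden \<notin> \<rat>"
proof
  assume "golden \<in> \<rat>"
  then obtain m n :: int where n: "0 < n" and cop: "coprime m n" and g: "golden = of_int m / of_int n"
    by (rule Rats_cases')
  have "(of_int m / of_int n) * (of_int m / of_int n) = 1 - (of_int m / of_int n :: real)"
    using golden_sq unfolding g .
  then have "of_int (m * m) = (of_int (n * (n - m)) :: real)"
    using n by (simp add: field_simps)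
  then have eq: "m * m = n * (n - m)" by (simp only: of_int_eq_iff)
  then have "n dvd m * m" by simp
  moreover have "coprime n (m * m)" using cop by (simp add: coprime_commute)
  ultimately have "n dvd 1" by (metis coprime_absorb_left)
  then have "n = 1" using n by simp
  then have "golden = of_int m" using g by simp
  then have "0 < m" "m < 1" using golden_bounds by linarith+
  then show False by simp
qed

text \<open>The norm \<open>m\<^sup>2 + m n - n\<^sup>2 = (m - n golden) (m + n (1 + golden))\<close> of \<open>m - n golden\<close> is a
  nonzero integer.\<close>

lemma golden_approx:
  assumes "0 < n"
  shows "1 / 4 \<le> real n * \<bar>real n * golden - of_int m\<bar>"
proof (rule ccontr)
  define x where "x = \<bar>real n * golden - of_int m\<bar>"
  define k where "k = m * m + m * int n - int n * int n"
  assume "\<not> 1 / 4 \<le> real n * \<bar>real n * golden - of_int m\<bar>"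
  then have nx: "real n * x < 1 / 4" unfolding x_def by simp
  have x0: "0 \<le> x" unfolding x_def by simp
  have n1: "1 \<le> real n" using assms by simp
  have "1 * x \<le> real n * x" using n1 x0 by (rule mult_right_mono)
  then have x4: "x < 1 / 4" using nx by simp
  have k: "of_int k = (of_int m - real n * golden) * (of_int m + real n * (1 + golden))"
    unfolding k_def of_int_add of_int_diff of_int_mult of_int_of_nat_eq using golden_sq by algebra
  \<comment> \<open>The second factor of the norm exceeds the first by at most \<open>3 * n\<close>,
    so the norm is below 1/4 + 3/4 in absolute value.\<close>
  have "\<bar>of_int m + real n * (1 + golden)\<bar> \<le> x + 3 * real n"
  proof -
    have "of_int m + real n * (1 + golden) = (of_int m - real n * golden) + real n * (1 + 2 * golden)"
      by (simp add: algebra_simps)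
    moreover have "0 \<le> real n * (1 + 2 * golden)" "real n * (1 + 2 * golden) \<le> real n * 3"
      using golden_bounds by (auto intro!: mult_left_mono)
    ultimately show ?thesis unfolding x_def by linarith
  qed
  then have "x * \<bar>of_int m + real n * (1 + golden)\<bar> \<le> x * (x + 3 * real n)"
    using x0 by (rule mult_left_mono)
  also have "\<dots> = x * x + 3 * (real n * x)" by (simp add: algebra_simps)
  also have "\<dots> < 1"
  proof -
    have "x * x \<le> x * 1" using x0 x4 by (intro mult_left_mono) auto
    then show ?thesis using x4 nx by simp
  qed
  finally have "\<bar>real_of_int k\<bar> < 1"
    unfolding k abs_mult x_def by (simp add: abs_minus_commute)
  then have "k = 0" by linarith
  \<comment> \<open>A vanishing factor of the norm makes \<open>golden\<close> rational.\<close>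
  then have "of_int m = real n * golden \<or> of_int m = - (real n * (1 + golden))"
    using k by auto
  then have "golden = of_int m / of_nat n \<or> golden = - (of_int m / of_nat n) - 1"
    using n1 by (auto simp: field_simps)
  moreover have "of_int m / of_nat n \<in> (\<rat> :: real set)" by simp
  ultimately show False using golden_irrational by (metis Rats_1 Rats_diff Rats_minus_iff)
qed

lemma badly_approximable_golden: "badly_approximable golden"
proof -
  have nonempty: "(\<int> :: real set) \<noteq> {}" using Ints_0 by blast
  have "1 / 4 \<le> real n * infdist (real n * golden) \<int>" if "1 \<le> n" for n
  proof -
    have "1 / (4 * real n) \<le> infdist (real n * golden) \<int>"
      unfolding infdist_notempty[OF nonempty]
    proof (rule cINF_greatest)
      fix z :: real assume "z \<in> \<int>"
      then obtain m where "z = of_int m" by (rule Ints_cases)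
      then show "1 / (4 * real n) \<le> dist (real n * golden) z"
        using golden_approx[of n m] that by (simp add: dist_real_def field_simps)
    qed (rule nonempty)
    then show ?thesis using that by (simp add: field_simps)
  qed
  then have "eventually (\<lambda>n. ereal (1 / 4) \<le> ereal (real n * infdist (real n * golden) \<int>)) sequentially"
    by (auto simp: eventually_sequentially)
  then have "ereal (1 / 4) \<le> liminf (\<lambda>n. ereal (real n * infdist (real n * golden) \<int>))"
    by (rule Liminf_bounded)
  moreover have "0 < ereal (1 / 4)" by simp
  ultimately have "0 < liminf (\<lambda>n. ereal (real n * infdist (real n * golden) \<int>))"
    by (rule less_le_trans[rotated])
  then show ?thesis unfolding badly_approximable_def using golden_irrational by blast
qed

section \<open>One-sided rational approximations of the golden number\<close>

text \<open>The convergents \<open>F 2n / F (2n+1)\<close> of \<open>golden\<close>, in the order numerator, denominator.\<close>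

fun golden_convergent :: "nat \<Rightarrow> nat \<times> nat" where
  "golden_convergent 0 = (0, 1)"
| "golden_convergent (Suc n) = (case golden_convergent n of (p, q) \<Rightarrow> (q + p, 2 * q + p))"

text \<open>One step of the recursion multiplies \<open>q * golden - p\<close> by
  \<open>1 - golden\<close>, which is \<open>golden * golden\<close>. Taking every second convergent
  keeps all errors positive.\<close>

lemma golden_convergent_error:
  "real (snd (golden_convergent n)) * golden = real (fst (golden_convergent n)) + golden * (golden * golden) ^ n"
proof (induction n)
  case (Suc n)
  obtain p q where pq: "golden_convergent n = (p, q)" by force
  have "golden * (golden * golden) ^ Suc n = (1 - golden) * (real q * golden - real p)"
    using Suc pq golden_sq by simp
  also have "\<dots> = real (2 * q + p) * golden - real (q + p)"
    unfolding of_nat_add of_nat_mult of_nat_numeral using golden_sq by algebra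
  finally show ?case using pq by simp
qed simp

lemma snd_golden_convergent_pos: "0 < snd (golden_convergent n)"
proof (induction n)
  case (Suc n)
  then show ?case by (cases "golden_convergent n") simp
qed simp

lemma snd_golden_convergent_mono: "m \<le> n \<Longrightarrow> snd (golden_convergent m) \<le> snd (golden_convergent n)"
  by (rule lift_Suc_mono_le) (auto split: prod.split)

text \<open>Since \<open>p \<le> q * golden\<close>, a step multiplies the denominator by at most
  \<open>2 + golden\<close>, the inverse of \<open>golden * golden\<close>.\<close>

lemma snd_golden_convergent_le: "real (snd (golden_convergent n)) * (golden * golden) ^ n \<le> 1"
proof (induction n)
  case (Suc n)
  obtain p q where pq: "golden_convergent n = (p, q)" by force
  have "0 \<le> golden * (golden * golden) ^ n" using golden_bounds by simp
  then have "real p \<le> real q * golden" using golden_convergent_error[of n] pq by simp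
  then have "real (2 * q + p) * (golden * golden) \<le> (2 * real q + real q * golden) * (golden * golden)"
    using golden_bounds by (intro mult_right_mono) auto
  also have "\<dots> = real q * ((2 + golden) * (golden * golden))" by (simp add: algebra_simps)
  also have "(2 + golden) * (golden * golden) = 1"
    unfolding golden_sq using golden_sq by (simp add: algebra_simps)
  finally have "real (2 * q + p) * (golden * golden) * (golden * golden) ^ n \<le> real q * (golden * golden) ^ n"
    using golden_bounds by (intro mult_right_mono) auto
  then show ?case using Suc pq by (simp add: mult.assoc)
qed simp

section \<open>A sparse subsequence with rapidly decreasing errors\<close>

text \<open>Square indices have growing gaps, so each error is small even against the preceding
  denominator. With equally spaced indices \<open>den n * err (Suc n)\<close> would not tend to
  0.\<close>

definition den :: "nat \<Rightarrow> nat" where "den n = snd (golden_convergent ((n + 1)\<^sup>2))"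
definition err :: "nat \<Rightarrow> real" where "err n = golden * (golden * golden) ^ ((n + 1)\<^sup>2)"

lemma den_golden: "real (den n) * golden = of_int (int (fst (golden_convergent ((n + 1)\<^sup>2)))) + err n"
  unfolding den_def err_def using golden_convergent_error by simp

lemma den_pos: "0 < den n" unfolding den_def by (rule snd_golden_convergent_pos)

lemma den_mono: "m \<le> n \<Longrightarrow> den m \<le> den n"
  unfolding den_def by (intro snd_golden_convergent_mono power_mono) auto

lemma err_pos: "0 < err n" unfolding err_def using golden_bounds by simp

lemma golden_sq_power_le: "(golden * golden) ^ (2 * n + 3) \<le> (1 / 4) ^ Suc n"
proof -
  have g: "0 \<le> golden * golden" "golden * golden \<le> 1 / 2"
    using golden_bounds by (simp_all add: golden_sq)
  have "(golden * golden) ^ (2 * n + 3) \<le> (1 / 2) ^ (2 * n + 3)"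
    using g by (intro power_mono) auto
  also have "\<dots> \<le> (1 / 2) ^ (2 * Suc n)" by (rule power_decreasing) auto
  also have "\<dots> = (1 / 4) ^ Suc n" by (simp only: power_mult) (simp add: power2_eq_square)
  finally show ?thesis .
qed

lemma square_Suc: "(Suc n + 1)\<^sup>2 = (n + 1)\<^sup>2 + (2 * n + 3)"
  by (simp add: power2_eq_square algebra_simps)

lemma err_Suc_le: "err (Suc n) \<le> err n / 4"
proof -
  have "(golden * golden) ^ (2 * n + 3) \<le> 1 / 4"
    using golden_sq_power_le[of n] power_decreasing[of 1 "Suc n" "1/4 :: real"] by simp
  then have "err n * (golden * golden) ^ (2 * n + 3) \<le> err n * (1 / 4)"
    using err_pos[of n] by (intro mult_left_mono) auto
  then show ?thesis unfolding err_def square_Suc power_add by (simp add: mult.assoc)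
qed

text \<open>The denominator cancels against the power in \<open>err n\<close>, leaving the gap
  factor with exponent \<open>2 * n + 3\<close>. This makes the supports of the functions
  \<open>t k\<close> summably small.\<close>

lemma den_err_le: "real (den n) * err (Suc n) \<le> (1 / 4) ^ Suc n"
proof -
  define r where "r = golden * golden"
  have "real (den n) * err (Suc n) = (real (den n) * r ^ (n + 1)\<^sup>2) * (golden * r ^ (2 * n + 3))"
    unfolding err_def square_Suc power_add r_def by (simp add: mult_ac)
  also have "\<dots> \<le> 1 * (1 * (1 / 4) ^ Suc n)"
    using golden_bounds golden_sq_power_le[of n] snd_golden_convergent_le[of "(n + 1)\<^sup>2"]
    unfolding r_def den_def by (intro mult_mono) auto
  finally show ?thesis by simp
qed

lemma err_add_le: "err (n + k) \<le> err n * (1 / 4) ^ k"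
proof (induction k)
  case (Suc k)
  then show ?case using err_Suc_le[of "n + k"] by simp
qed simp

lemma err_sparse_le: "err (n + 2 * j) \<le> err n * (1 / 16) ^ j"
  using err_add_le[of n "2 * j"] by (simp add: power_mult power2_eq_square)

lemma summable_err_sparse: "summable (\<lambda>j. err (n + 2 * j))"
proof (rule summable_comparison_test')
  show "summable (\<lambda>j. err n * (1 / 16) ^ j)" by (intro summable_mult summable_geometric) simp
  show "norm (err (n + 2 * j)) \<le> err n * (1 / 16) ^ j" if "0 \<le> j" for j
    using err_sparse_le[of n j] err_pos[of "n + 2 * j"] by simp
qed

lemma suminf_err_sparse_le: "(\<Sum>j. err (n + 2 * j)) \<le> 2 * err n"
proof -
  have "(\<Sum>j. err (n + 2 * j)) \<le> (\<Sum>j. err n * (1 / 16) ^ j)"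
    by (intro suminf_le err_sparse_le summable_err_sparse summable_mult summable_geometric) simp
  also have "\<dots> = err n * (16 / 15)" by (simp add: suminf_mult summable_geometric suminf_geometric)
  also have "\<dots> \<le> err n * 2" using err_pos[of n] by (intro mult_left_mono) auto
  finally show ?thesis by simp
qed


section \<open>Floor differences, arcs of the circle and rotation orbits\<close>

text \<open>With S the shift, both sides are (1 - S^a)(1 - S^b)/(1 - S) applied to \<open>F\<close>
  at 0, an expression symmetric in \<open>a\<close> and \<open>b\<close>.\<close>

lemma sum_diff_shift_swap:
  fixes F :: "nat \<Rightarrow> int"
  shows "(\<Sum>i<b. F i - F (i + a)) = (\<Sum>i<a. F i - F (i + b))"
proof (induction a)
  case (Suc a)
  have "(\<Sum>i<b. F (i + a) - F (Suc i + a)) = F a - F (b + a)"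
    using sum_lessThan_telescope'[of "\<lambda>i. F (i + a)" b] by simp
  then show ?case
    using Suc by (simp add: sum_subtractf add.commute)
qed simp

text \<open>For s in [0,1] this is the 1-periodic extension of the indicator of [0,s). The floor
  form lets integer shifts cancel and sums telescope exactly.\<close>

definition floor_step :: "real \<Rightarrow> real \<Rightarrow> int" where
  "floor_step s x = \<lfloor>x\<rfloor> - \<lfloor>x - s\<rfloor>"

lemma floor_step_add_int [simp]: "floor_step s (x + of_int m) = floor_step s x"
proof -
  have "x + of_int m - s = (x - s) + of_int m" by simp
  then show ?thesis unfolding floor_step_def by (metis add_diff_cancel_right floor_add_int)
qed

lemma floor_step_nonneg: "0 \<le> s \<Longrightarrow> 0 \<le> floor_step s x"
  unfolding floor_step_def by (simp add: floor_mono)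

lemma floor_step_pos: "0 \<le> x \<Longrightarrow> x < s \<Longrightarrow> 1 \<le> floor_step s x"
  using floor_less_iff[of "x - s" 0] zero_le_floor[of x] unfolding floor_step_def by linarith

lemma floor_step_eq_0: "0 \<le> s \<Longrightarrow> s \<le> frac x \<Longrightarrow> floor_step s x = 0"
  unfolding floor_step_def frac_def by linarith

lemma floor_step_indicator:
  assumes "0 \<le> s" "0 \<le> c" "c + s \<le> 1" "x \<in> {0..<1}"
  shows "floor_step s (x - c) = indicator {c..<c+s} x"
proof -
  have "\<lfloor>x - c\<rfloor> = (if x < c then -1 else 0)" "\<lfloor>x - c - s\<rfloor> = (if x < c + s then -1 else 0)"
    using assms by (auto simp: floor_eq_iff)
  then show ?thesis using assms unfolding floor_step_def by (simp add: indicator_def)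
qed

text \<open>The floor function is right-continuous, and \<open>z - c k\<close> approaches
  \<open>z - l\<close> from above.\<close>

lemma eventually_floor_diff_eq:
  fixes z l :: real
  assumes "c \<longlonglongrightarrow> l" "\<And>k. c k \<le> l"
  shows "eventually (\<lambda>k. \<lfloor>z - c k\<rfloor> = \<lfloor>z - l\<rfloor>) sequentially"
proof -
  have "z - \<lfloor>z - l\<rfloor> - 1 < l" by linarith
  from order_tendstoD(1)[OF assms(1) this] show ?thesis
  proof eventually_elim
    case (elim k)
    then show ?case using assms(2)[of k] by linarith
  qed
qed

text \<open>Lifts to the line of the circle arc [s, s+r). Two suffice, as the floor of
  \<open>x - s\<close> takes at most two values for x in [0,1). Parts outside [0,1) are kept, which
  costs only a factor 2 in measure.\<close>

definition unit_arc_cover :: "real \<Rightarrow> real \<Rightarrow> real set" where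
  "unit_arc_cover s r = (\<Union>m\<in>{0,1::int}. {of_int (\<lfloor>-s\<rfloor> + m) + s..<of_int (\<lfloor>-s\<rfloor> + m) + s + r})"

lemma unit_arc_cover:
  assumes "x \<in> {0..<1}" "frac (x - s) < r"
  shows "x \<in> unit_arc_cover s r"
proof -
  have "\<lfloor>x - s\<rfloor> = \<lfloor>-s\<rfloor> \<or> \<lfloor>x - s\<rfloor> = \<lfloor>-s\<rfloor> + 1"
    using assms(1) by (auto; linarith)
  moreover have "of_int \<lfloor>x - s\<rfloor> + s \<le> x" "x < of_int \<lfloor>x - s\<rfloor> + s + r"
    using assms(2) unfolding frac_def by linarith+
  ultimately show ?thesis
    unfolding unit_arc_cover_def by auto
qed

lemma unit_arc_cover_fmeasurable [simp]: "unit_arc_cover s r \<in> fmeasurable lebesgue"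
  unfolding unit_arc_cover_def
  by (intro fmeasurable.finite_UN) (auto intro!: bounded_set_imp_lmeasurable)

lemma unit_arc_cover_sets [measurable]: "unit_arc_cover s r \<in> sets lebesgue"
  using unit_arc_cover_fmeasurable by (rule fmeasurableD)

lemma measure_unit_arc_cover:
  assumes "0 \<le> r"
  shows "measure lebesgue (unit_arc_cover s r) \<le> 2 * r"
proof -
  have "measure lebesgue (unit_arc_cover s r) \<le>
    (\<Sum>m\<in>{0,1::int}. measure lebesgue {of_int (\<lfloor>-s\<rfloor> + m) + s..<of_int (\<lfloor>-s\<rfloor> + m) + s + r})"
    unfolding unit_arc_cover_def by (rule measure_UNION_le) auto
  also have "\<dots> = 2 * r" using assms by simp
  finally show ?thesis .
qed

lemma rotation_funpow:
  assumes "x \<in> {0..<1}"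
  shows "(rotation \<alpha> ^^ n) x = frac (x + real n * \<alpha>)"
proof (induction n)
  case 0
  then show ?case using assms by (simp add: frac_eq)
next
  case (Suc n)
  have "frac (frac (x + real n * \<alpha>) + \<alpha>) = frac (x + real (Suc n) * \<alpha>)"
  proof -
    have "x + real (Suc n) * \<alpha> =
      (frac (x + real n * \<alpha>) + \<alpha>) + of_int \<lfloor>x + real n * \<alpha>\<rfloor>"
      by (simp add: frac_def algebra_simps)
    moreover have "frac (z + of_int m) = frac z" for z :: real and m by (simp add: frac_def)
    ultimately show ?thesis by metis
  qed
  then show ?case using Suc by (simp add: rotation_def)
qed

section \<open>Coboundaries with nonnegative transfer functions\<close>

text \<open>The conditions \<open>b_le_a\<close> and \<open>tail_less\<close> make \<open>H\<close>
  large somewhere, \<open>summable_ad\<close> and \<open>summable_be\<close> serve Borel-Cantelli,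
  and \<open>sum_le_1\<close> fits both arcs into [0,1).\<close>

locale interleaved_approximations =
  fixes \<alpha> :: real and a b :: "nat \<Rightarrow> nat" and u v :: "nat \<Rightarrow> int" and e d :: "nat \<Rightarrow> real"
  assumes e_eq: "real (a j) * \<alpha> = of_int (u j) + e j"
    and d_eq: "real (b j) * \<alpha> = of_int (v j) + d j"
    and e_pos: "0 < e j" and d_pos: "0 < d j"
    and a_pos: "0 < a j" and b_le_a: "b j \<le> a (Suc j)"
    and summable_e: "summable e" and summable_d: "summable d"
    and tail_less: "(\<Sum>j. e (j + Suc k)) < d k"
    and summable_ad: "summable (\<lambda>k. real (\<Sum>j\<le>k. a j) * d k)"
    and summable_be: "summable (\<lambda>k. real (b k) * (\<Sum>j. e (j + Suc k)))"
    and sum_le_1: "suminf e + suminf d \<le> 1"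
begin

definition "\<beta> = suminf e"
definition "c = suminf d"
definition "A k = (\<Sum>j\<le>k. a j)"
definition "B k = (\<Sum>j\<le>k. e j)"
definition "N k = (\<Sum>j<k. b j)"
definition "tail k = (\<Sum>j. e (j + Suc k))"

text \<open>The two sums come from cutting [0, \<beta>) at \<open>B k\<close>: the piece of length
  \<open>B k\<close>, congruent to \<open>A k * \<alpha>\<close>, yields \<open>A k\<close> arcs of
  length \<open>d k\<close>; the rest yields \<open>b k\<close> arcs of length
  \<open>tail k\<close>.\<close>

definition t :: "nat \<Rightarrow> real \<Rightarrow> int" where
  "t k y = (\<Sum>i<A k. floor_step (d k) (y - real i * \<alpha>)) +
           (\<Sum>i<b k. floor_step (tail k) (y - real i * \<alpha> - B k))"

definition H :: "nat \<Rightarrow> real \<Rightarrow> int" where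
  "H K x = (\<Sum>k<K. t k (x - real (N k) * \<alpha>))"

definition f :: "real \<Rightarrow> int" where
  "f x = floor_step \<beta> x - floor_step \<beta> (x - c)"

lemma B_plus_tail: "B k + tail k = \<beta>"
  using suminf_split_initial_segment[OF summable_e, of "Suc k"]
  unfolding B_def tail_def \<beta>_def by (simp add: lessThan_Suc_atMost)

lemma tail_pos: "0 < tail k"
  unfolding tail_def using summable_e e_pos
  by (intro suminf_pos) (simp_all only: summable_iff_shift)

lemma \<beta>_pos: "0 < \<beta>" unfolding \<beta>_def using summable_e e_pos by (rule suminf_pos)
lemma c_pos: "0 < c" unfolding c_def using summable_d d_pos by (rule suminf_pos)
lemma \<beta>_c_le: "c + \<beta> \<le> 1" using sum_le_1 unfolding \<beta>_def c_def by simp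

lemma t_nonneg: "0 \<le> t k y"
  unfolding t_def using d_pos[of k] tail_pos[of k]
  by (intro add_nonneg_nonneg sum_nonneg floor_step_nonneg) auto

lemma A_eq: "real (A k) * \<alpha> = of_int (\<Sum>j\<le>k. u j) + B k"
  unfolding A_def B_def by (simp add: sum_distrib_right e_eq sum.distrib)

lemma N_eq: "real (N k) * \<alpha> = of_int (\<Sum>j<k. v j) + (\<Sum>j<k. d j)"
  unfolding N_def by (simp add: sum_distrib_right d_eq sum.distrib)

text \<open>Modulo integers, the piece of length \<open>B k\<close> is a floor difference with lag
  \<open>A k\<close>. Swapping turns \<open>b k\<close> differences of lag \<open>A k\<close> into
  \<open>A k\<close> differences of lag \<open>b k\<close>, which are steps of the short length
  \<open>d k\<close>.\<close>

lemma sum_floor_step_\<beta>: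
  "(\<Sum>i<b k. floor_step \<beta> (y - real i * \<alpha>)) = t k y + (int (A k) * v k - int (b k) * (\<Sum>j\<le>k. u j))"
proof -
  define U where "U = (\<Sum>j\<le>k. u j)"
  define F where "F i = \<lfloor>y - real i * \<alpha>\<rfloor>" for i
  have 1: "floor_step \<beta> (y - real i * \<alpha>) =
      (F i - F (i + A k)) - U + floor_step (tail k) (y - real i * \<alpha> - B k)" for i
  proof -
    have "y - real i * \<alpha> - B k = (y - real (i + A k) * \<alpha>) + of_int U"
      using A_eq[of k] by (simp add: algebra_simps U_def)
    then have "\<lfloor>y - real i * \<alpha> - B k\<rfloor> = F (i + A k) + U"
      unfolding F_def by (metis floor_add_int)
    moreover have "y - real i * \<alpha> - \<beta> = y - real i * \<alpha> - B k - tail k"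
      using B_plus_tail[of k] by simp
    ultimately show ?thesis unfolding floor_step_def by (simp only: F_def)
  qed
  have 2: "F i - F (i + b k) = floor_step (d k) (y - real i * \<alpha>) + v k" for i
  proof -
    have "y - real i * \<alpha> - d k = (y - real (i + b k) * \<alpha>) + of_int (v k)"
      using d_eq[of k] by (simp add: algebra_simps)
    then have "\<lfloor>y - real i * \<alpha> - d k\<rfloor> = F (i + b k) + v k"
      unfolding F_def by (metis floor_add_int)
    then show ?thesis unfolding floor_step_def F_def by simp
  qed
  have "(\<Sum>i<b k. floor_step \<beta> (y - real i * \<alpha>)) =
     (\<Sum>i<b k. F i - F (i + A k)) - int (b k) * U
       + (\<Sum>i<b k. floor_step (tail k) (y - real i * \<alpha> - B k))"
    unfolding 1 by (simp add: sum.distrib sum_subtractf)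
  also have "(\<Sum>i<b k. F i - F (i + A k)) = (\<Sum>i<A k. F i - F (i + b k))"
    by (rule sum_diff_shift_swap)
  also have "\<dots> = (\<Sum>i<A k. floor_step (d k) (y - real i * \<alpha>)) + int (A k) * v k"
    unfolding 2 by (simp add: sum.distrib)
  finally show ?thesis unfolding t_def U_def by simp
qed

text \<open>The additive constant cancels and the sum of \<open>b k\<close> rotated copies
  telescopes.\<close>

lemma t_diff: "t k y - t k (y - \<alpha>) = floor_step \<beta> y - floor_step \<beta> (y - real (b k) * \<alpha>)"
proof -
  define G where "G i = floor_step \<beta> (y - real i * \<alpha>)" for i
  have G: "floor_step \<beta> (y - \<alpha> - real i * \<alpha>) = G (Suc i)" for i
    unfolding G_def by (simp add: algebra_simps)
  have "t k y - t k (y - \<alpha>) = (\<Sum>i<b k. G i) - (\<Sum>i<b k. G (Suc i))"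
    using sum_floor_step_\<beta>[of y k] sum_floor_step_\<beta>[of "y - \<alpha>" k]
    unfolding G G_def[symmetric] by simp
  also have "\<dots> = G 0 - G (b k)"
    using sum_lessThan_telescope'[of G "b k"] by (simp add: sum_subtractf)
  finally show ?thesis unfolding G_def by simp
qed

text \<open>The offsets \<open>N k\<close> chain the single shifts together, as
  \<open>N K * \<alpha>\<close> is congruent to the sum of the first \<open>K\<close> errors
  \<open>d j\<close>.\<close>

lemma H_diff: "H K x - H K (x - \<alpha>) = floor_step \<beta> x - floor_step \<beta> (x - (\<Sum>j<K. d j))"
proof -
  define G where "G k = floor_step \<beta> (x - real (N k) * \<alpha>)" for k
  have "t k (x - real (N k) * \<alpha>) - t k (x - \<alpha> - real (N k) * \<alpha>) = G k - G (Suc k)" for k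
    using t_diff[of k "x - real (N k) * \<alpha>"] unfolding G_def N_def by (simp add: algebra_simps)
  then have "H K x - H K (x - \<alpha>) = (\<Sum>k<K. G k - G (Suc k))"
    unfolding H_def by (simp flip: sum_subtractf)
  also have "\<dots> = G 0 - G K" by (rule sum_lessThan_telescope')
  also have "G K = floor_step \<beta> (x - (\<Sum>j<K. d j))"
  proof -
    have "x - (\<Sum>j<K. d j) = (x - real (N K) * \<alpha>) + of_int (\<Sum>j<K. v j)"
      using N_eq[of K] by simp
    then show ?thesis unfolding G_def by (metis floor_step_add_int)
  qed
  finally show ?thesis unfolding G_def N_def by simp
qed

lemma H_mono: "K \<le> L \<Longrightarrow> H K x \<le> H L x"
  unfolding H_def using t_nonneg by (intro sum_mono2) auto

text \<open>Only finitely many orbit points occur, so one \<open>K\<close> serves all of them.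
  Working with eventual equality avoids a limit of \<open>H K\<close>, which may be
  infinite.\<close>

lemma eventually_sum_f:
  "eventually (\<lambda>K. (\<Sum>n=0..M. f (x + real n * \<alpha>)) = H K (x + real M * \<alpha>) - H K (x - \<alpha>)) sequentially"
proof -
  have lim: "(\<lambda>K. \<Sum>j<K. d j) \<longlonglongrightarrow> c"
    unfolding c_def using summable_d by (rule summable_LIMSEQ)
  have le: "(\<Sum>j<K. d j) \<le> c" for K
    unfolding c_def using summable_d d_pos by (intro sum_le_suminf) (auto simp: less_imp_le)
  have "eventually (\<lambda>K. f y = H K y - H K (y - \<alpha>)) sequentially" for y
  proof -
    have "eventually (\<lambda>K. \<lfloor>y - (\<Sum>j<K. d j)\<rfloor> = \<lfloor>y - c\<rfloor>) sequentially"
      using lim le by (rule eventually_floor_diff_eq)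
    moreover have "eventually (\<lambda>K. \<lfloor>y - \<beta> - (\<Sum>j<K. d j)\<rfloor> = \<lfloor>y - \<beta> - c\<rfloor>) sequentially"
      using lim le by (rule eventually_floor_diff_eq)
    ultimately show ?thesis
    proof eventually_elim
      case (elim K)
      then show ?case
        unfolding H_diff f_def floor_step_def by (simp add: algebra_simps)
    qed
  qed
  then have "eventually (\<lambda>K. \<forall>n\<in>{0..M}. f (x + real n * \<alpha>) =
      H K (x + real n * \<alpha>) - H K (x + real n * \<alpha> - \<alpha>)) sequentially"
    by (intro eventually_ball_finite) auto
  then show ?thesis
  proof eventually_elim
    case (elim K)
    define G where "G n = H K (x + real n * \<alpha> - \<alpha>)" for n
    have "(\<Sum>n=0..M. f (x + real n * \<alpha>)) = (\<Sum>n<Suc M. G (Suc n) - G n)"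
      using elim unfolding G_def
      by (intro sum.cong) (auto simp: algebra_simps less_Suc_eq_le)
    also have "\<dots> = G (Suc M) - G 0" by (rule sum_lessThan_telescope)
    finally show ?case unfolding G_def by (simp add: algebra_simps)
  qed
qed

text \<open>The orbit point \<open>a 1 + \<dots> + a k\<close> is one of the \<open>A k\<close> translates entering \<open>t k\<close>, for all
  \<open>k\<close> simultaneously; this is what makes \<open>H\<close> unbounded.\<close>

lemma H_large:
  assumes "(\<Sum>j=1..K. e j) \<le> x" "x < (\<Sum>j=1..K. e j) + tail K"
  shows "int K < H (Suc K) x"
proof -
  have "1 \<le> t k (x - real (N k) * \<alpha>)" if "k \<le> K" for k
  proof -
    define X where "X = (\<Sum>j=1..k. a j)"
    define y where "y = x - (\<Sum>j=1..k. e j)"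
    \<comment> \<open>The index \<open>X - N k\<close> must be a true natural number below
      \<open>A k\<close>; the interleaving gives the first, \<open>a 0 > 0\<close> the
      second.\<close>
    have N_X: "N k \<le> X"
    proof -
      have "N k \<le> (\<Sum>j<k. a (Suc j))" unfolding N_def using b_le_a by (rule sum_mono)
      also have "\<dots> = X" unfolding X_def by (simp add: sum.atLeast1_atMost_eq)
      finally show ?thesis .
    qed
    have "A k = a 0 + X"
      unfolding A_def X_def by (simp add: atMost_atLeast0 sum.atLeast_Suc_atMost)
    then have X_A: "X - N k < A k" using a_pos[of 0] by simp
    \<comment> \<open>The right side is free of \<open>k\<close>, so the upper end of the interval
      for \<open>K\<close> is also the upper end for every smaller \<open>k\<close>.\<close>
    have split: "(\<Sum>j=1..k. e j) + tail k = \<beta> - e 0" for k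
      using B_plus_tail[of k] unfolding B_def
      by (simp add: atMost_atLeast0 sum.atLeast_Suc_atMost)
    have "(\<Sum>j=1..k. e j) \<le> (\<Sum>j=1..K. e j)"
      using that e_pos by (intro sum_mono2) (auto simp: less_imp_le)
    then have "0 \<le> y" using assms(1) unfolding y_def by simp
    moreover have "y < d k"
      using assms(2) split[of k] split[of K] tail_less[of k]
      unfolding y_def tail_def by simp
    ultimately have "1 \<le> floor_step (d k) y" by (rule floor_step_pos)
    also have "y = (x - real (N k) * \<alpha> - real (X - N k) * \<alpha>) + of_int (\<Sum>j=1..k. u j)"
    proof -
      have "real X * \<alpha> = of_int (\<Sum>j=1..k. u j) + (\<Sum>j=1..k. e j)"
        unfolding X_def by (simp add: sum_distrib_right e_eq sum.distrib)
      then show ?thesis using N_X unfolding y_def by (simp add: of_nat_diff algebra_simps)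
    qed
    also have "floor_step (d k) \<dots> = floor_step (d k) (x - real (N k) * \<alpha> - real (X - N k) * \<alpha>)"
      by (rule floor_step_add_int)
    also have "\<dots> \<le> (\<Sum>i<A k. floor_step (d k) (x - real (N k) * \<alpha> - real i * \<alpha>))"
      using X_A d_pos[of k] by (intro member_le_sum floor_step_nonneg) auto
    also have "\<dots> \<le> t k (x - real (N k) * \<alpha>)"
      unfolding t_def using tail_pos[of k] by (simp add: sum_nonneg floor_step_nonneg)
    finally show ?thesis .
  qed
  then have "(\<Sum>k<Suc K. 1) \<le> H (Suc K) x" unfolding H_def by (intro sum_mono) auto
  then show ?thesis by simp
qed

section \<open>Density of orbits and almost sure boundedness\<close>

text \<open>Rotating \<open>a j\<close> times moves a point to the right by \<open>e j\<close>, and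
  steps shorter than \<open>r\<close> cannot jump over the target interval.\<close>

lemma orbit_dense:
  assumes "0 < r"
  obtains n :: nat and m :: int where "y \<le> x + real n * \<alpha> + of_int m" "x + real n * \<alpha> + of_int m < y + r"
proof -
  have "e \<longlonglongrightarrow> 0" using summable_e by (rule summable_LIMSEQ_zero)
  then have "eventually (\<lambda>j. e j < r) sequentially" using assms by (rule order_tendstoD)
  then obtain j where j: "e j < r" by (auto simp: eventually_sequentially)
  \<comment> \<open>The integer \<open>L\<close> lifts the target to the right of \<open>x\<close>,
    since only steps to the right are available.\<close>
  define L where "L = \<lceil>x - y\<rceil>"
  define q where "q = nat \<lceil>(y + of_int L - x) / e j\<rceil>"
  have "0 \<le> (y + of_int L - x) / e j"
    using e_pos[of j] unfolding L_def by (intro divide_nonneg_pos) linarith+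
  then have "(y + of_int L - x) / e j \<le> real q" "real q < (y + of_int L - x) / e j + 1"
    unfolding q_def by linarith+
  then have *: "y + of_int L - x \<le> real q * e j" "real q * e j < y + of_int L - x + e j"
    using e_pos[of j] by (simp_all add: field_simps)
  have "real (q * a j) * \<alpha> = of_int (int q * u j) + real q * e j"
    using e_eq[of j] by (simp add: mult.assoc distrib_left)
  with * j show ?thesis
    by (intro that[where n = "q * a j" and m = "- (int q * u j) - L"]) auto
qed

lemma H_periodic: "H K (x + of_int m) = H K x"
proof -
  have *: "floor_step s (y + of_int m - z) = floor_step s (y - z)" for s y z
    using floor_step_add_int[of s "y - z" m] by (simp add: algebra_simps)
  show ?thesis unfolding H_def t_def diff_diff_eq * ..
qed

lemma f_periodic: "f (x + of_int m) = f x"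
  unfolding f_def using floor_step_add_int[of \<beta> "x - c" m] by (simp add: algebra_simps)

text \<open>By Borel-Cantelli, as \<open>t k\<close> vanishes off \<open>A k\<close> arcs of length
  \<open>d k\<close> and \<open>b k\<close> arcs of length \<open>tail k\<close>. The base point
  \<open>x - \<alpha>\<close> is where the telescoped Birkhoff sum starts.\<close>

lemma AE_eventually_t_eq_0:
  "AE x in lebesgue. x \<in> {0..<1} \<longrightarrow>
     eventually (\<lambda>k. t k (x - \<alpha> - real (N k) * \<alpha>) = 0) sequentially"
proof -
  define W1 where "W1 k = (\<Union>i<A k. unit_arc_cover (\<alpha> + real (N k) * \<alpha> + real i * \<alpha>) (d k))" for k
  define W2 where "W2 k = (\<Union>i<b k. unit_arc_cover (\<alpha> + real (N k) * \<alpha> + real i * \<alpha> + B k) (tail k))" for k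
  have fm: "W1 k \<in> fmeasurable lebesgue" "W2 k \<in> fmeasurable lebesgue" for k
    unfolding W1_def W2_def by (auto intro!: fmeasurable.finite_UN)
  have le: "measure lebesgue (W1 k \<union> W2 k) \<le> 2 * (real (A k) * d k) + 2 * (real (b k) * tail k)" for k
  proof -
    have "measure lebesgue (W1 k) \<le> (\<Sum>i<A k. 2 * d k)"
      unfolding W1_def using d_pos[of k]
      by (intro order.trans[OF measure_UNION_le] sum_mono measure_unit_arc_cover) auto
    moreover have "measure lebesgue (W2 k) \<le> (\<Sum>i<b k. 2 * tail k)"
      unfolding W2_def using tail_pos[of k]
      by (intro order.trans[OF measure_UNION_le] sum_mono measure_unit_arc_cover) auto
    moreover have "measure lebesgue (W1 k \<union> W2 k) \<le> measure lebesgue (W1 k) + measure lebesgue (W2 k)"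
      using fm by (intro measure_Un_le) auto
    ultimately show ?thesis by simp
  qed
  have "AE x in lebesgue. eventually (\<lambda>k. x \<in> space lebesgue - (W1 k \<union> W2 k)) sequentially"
  proof (rule borel_cantelli_AE1)
    show "W1 k \<union> W2 k \<in> sets lebesgue" for k using fm by auto
    show "emeasure lebesgue (W1 k \<union> W2 k) < \<infinity>" for k
      using fm by (metis fmeasurable.Un fmeasurableD2 infinity_ennreal_def less_top)
    show "summable (\<lambda>k. measure lebesgue (W1 k \<union> W2 k))"
    proof (rule summable_comparison_test')
      show "summable (\<lambda>k. 2 * (real (A k) * d k) + 2 * (real (b k) * tail k))"
        using summable_ad summable_be unfolding A_def tail_def
        by (intro summable_add summable_mult)
      show "norm (measure lebesgue (W1 k \<union> W2 k)) \<le> 2 * (real (A k) * d k) + 2 * (real (b k) * tail k)"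
        if "0 \<le> k" for k using le[of k] by simp
    qed
  qed
  then show ?thesis
  proof eventually_elim
    case (elim x)
    show ?case
    proof
      assume x: "x \<in> {0..<1}"
      from elim show "eventually (\<lambda>k. t k (x - \<alpha> - real (N k) * \<alpha>) = 0) sequentially"
      proof eventually_elim
        case (elim k)
        have "floor_step (d k) (x - \<alpha> - real (N k) * \<alpha> - real i * \<alpha>) = 0" if "i < A k" for i
        proof (rule floor_step_eq_0)
          have "x \<notin> unit_arc_cover (\<alpha> + real (N k) * \<alpha> + real i * \<alpha>) (d k)"
            using elim that unfolding W1_def by auto
          then show "d k \<le> frac (x - \<alpha> - real (N k) * \<alpha> - real i * \<alpha>)"
            using unit_arc_cover[OF x] by (force simp: algebra_simps)
        qed (use d_pos[of k] in simp)
        moreover have "floor_step (tail k) (x - \<alpha> - real (N k) * \<alpha> - real i * \<alpha> - B k) = 0" if "i < b k" for i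
        proof (rule floor_step_eq_0)
          have "x \<notin> unit_arc_cover (\<alpha> + real (N k) * \<alpha> + real i * \<alpha> + B k) (tail k)"
            using elim that unfolding W2_def by auto
          then show "tail k \<le> frac (x - \<alpha> - real (N k) * \<alpha> - real i * \<alpha> - B k)"
            using unit_arc_cover[OF x] by (force simp: algebra_simps)
        qed (use tail_pos[of k] in simp)
        ultimately show ?case unfolding t_def by simp
      qed
    qed
  qed
qed

lemma H_bounded:
  assumes "eventually (\<lambda>k. t k (x - real (N k) * \<alpha>) = 0) sequentially"
  obtains C where "\<And>K. H K x \<le> C"
proof -
  from assms obtain K0 where K0: "\<And>k. K0 \<le> k \<Longrightarrow> t k (x - real (N k) * \<alpha>) = 0"
    by (auto simp: eventually_sequentially)
  have "H K x \<le> H K0 x" for K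
  proof (cases "K \<le> K0")
    case False
    then have "H K x = H K0 x"
      unfolding H_def using K0 by (intro sum.mono_neutral_right) auto
    then show ?thesis by simp
  qed (rule H_mono)
  then show ?thesis by (rule that)
qed

section \<open>Birkhoff sums and the integral\<close>

lemma sum_f_bounded_below_unbounded:
  assumes "\<And>K. H K (x - \<alpha>) \<le> C"
  shows "- C \<le> (\<Sum>n=0..M. f (x + real n * \<alpha>))"
    and "\<exists>M. L \<le> (\<Sum>n=0..M. f (x + real n * \<alpha>))"
proof -
  have "\<exists>K. (\<Sum>n=0..M. f (x + real n * \<alpha>)) = H K (x + real M * \<alpha>) - H K (x - \<alpha>)"
    using eventually_sum_f[of x M] by (auto simp: eventually_sequentially)
  then obtain K where K: "(\<Sum>n=0..M. f (x + real n * \<alpha>)) = H K (x + real M * \<alpha>) - H K (x - \<alpha>)" ..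
  have "0 \<le> H K (x + real M * \<alpha>)" unfolding H_def using t_nonneg by (rule sum_nonneg)
  then show "- C \<le> (\<Sum>n=0..M. f (x + real n * \<alpha>))"
    using K assms[of K] by simp
next
  \<comment> \<open>Chosen so that exceeding \<open>K\<close> leaves at least \<open>L\<close> after
    subtracting \<open>C\<close>.\<close>
  define K where "K = nat (L + C)"
  obtain M m where
    "(\<Sum>j=1..K. e j) \<le> x + real M * \<alpha> + of_int m" "x + real M * \<alpha> + of_int m < (\<Sum>j=1..K. e j) + tail K"
    using orbit_dense[OF tail_pos] by blast
  then have "int K < H (Suc K) (x + real M * \<alpha>)"
    using H_large H_periodic by metis
  \<comment> \<open>The index where the identity holds depends on \<open>M\<close>, so it is also
    taken beyond \<open>Suc K\<close>; monotonicity of \<open>H\<close> carries the bound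
    over.\<close>
  moreover have "eventually (\<lambda>k. (\<Sum>n=0..M. f (x + real n * \<alpha>)) = H k (x + real M * \<alpha>) - H k (x - \<alpha>)
      \<and> Suc K \<le> k) sequentially"
    by (intro eventually_conj eventually_sum_f eventually_ge_at_top)
  then obtain k where "(\<Sum>n=0..M. f (x + real n * \<alpha>)) = H k (x + real M * \<alpha>) - H k (x - \<alpha>)" "Suc K \<le> k"
    by (auto simp: eventually_sequentially)
  moreover have "H (Suc K) (x + real M * \<alpha>) \<le> H k (x + real M * \<alpha>)"
    using \<open>Suc K \<le> k\<close> by (rule H_mono)
  ultimately have "L \<le> (\<Sum>n=0..M. f (x + real n * \<alpha>))"
    using assms[of k] unfolding K_def by linarith
  then show "\<exists>M. L \<le> (\<Sum>n=0..M. f (x + real n * \<alpha>))" ..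
qed

lemma f_eq_indicators:
  "x \<in> {0..<1} \<Longrightarrow> f x = indicator {0..<\<beta>} x - indicator {c..<c+\<beta>} x"
  using floor_step_indicator[of \<beta> c x] floor_step_indicator[of \<beta> 0 x] \<beta>_pos c_pos \<beta>_c_le
  unfolding f_def by simp

lemma integral_f: "(LINT x:{0..<1}|lebesgue. real_of_int (f x)) = 0"
proof -
  have "(LINT x:{0..<1}|lebesgue. real_of_int (f x)) =
    (LINT x|lebesgue. indicat_real {0..<\<beta>} x - indicat_real {c..<c+\<beta>} x)"
    unfolding set_lebesgue_integral_def
  proof (rule Bochner_Integration.integral_cong)
    fix x :: real
    show "indicat_real {0..<1} x *\<^sub>R real_of_int (f x) = indicat_real {0..<\<beta>} x - indicat_real {c..<c+\<beta>} x"
    proof (cases "x \<in> {0..<1}")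
      case True
      then show ?thesis using f_eq_indicators[OF True] by (simp add: indicator_def)
    next
      case False
      then show ?thesis using \<beta>_pos c_pos \<beta>_c_le by (auto simp: indicator_def)
    qed
  qed simp
  also have "\<dots> = measure lebesgue {0..<\<beta>} - measure lebesgue {c..<c+\<beta>}"
    by (subst Bochner_Integration.integral_diff) (auto intro!: lmeasurable_iff_integrable[THEN iffD1] bounded_set_imp_lmeasurable)
  also have "\<dots> = 0" using \<beta>_pos by simp
  finally show ?thesis .
qed

lemma limits_f:
  "AE x in lebesgue. x \<in> {0..<1} \<longrightarrow>
     liminf (\<lambda>N. ereal (real_of_int (\<Sum>i=0..N. f ((rotation \<alpha> ^^ i) x)))) > -\<infinity> \<and>
     limsup (\<lambda>N. ereal (real_of_int (\<Sum>i=0..N. f ((rotation \<alpha> ^^ i) x)))) = \<infinity>"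
  using AE_eventually_t_eq_0
proof eventually_elim
  case (elim x)
  show ?case
  proof
    assume x: "x \<in> {0..<1}"
    define S where "S M = (\<Sum>n=0..M. f (x + real n * \<alpha>))" for M
    have "f ((rotation \<alpha> ^^ i) x) = f (x + real i * \<alpha>)" for i
      using f_periodic[of "x + real i * \<alpha>" "- \<lfloor>x + real i * \<alpha>\<rfloor>"] rotation_funpow[OF x]
      by (simp add: frac_def)
    then have S: "(\<Sum>i=0..M. f ((rotation \<alpha> ^^ i) x)) = S M" for M unfolding S_def by simp
    obtain C where C: "\<And>K. H K (x - \<alpha>) \<le> C" using H_bounded elim x by blast
    have low: "- C \<le> S M" and up: "\<exists>M. L \<le> S M" for M L
      using sum_f_bounded_below_unbounded[OF C] unfolding S_def by auto
    have "- \<infinity> < ereal (- C)" by simp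
    also have "\<dots> \<le> liminf (\<lambda>M. ereal (S M))"
      using low by (intro Liminf_bounded always_eventually) (auto simp flip: of_int_minus)
    finally have "- \<infinity> < liminf (\<lambda>M. ereal (S M))" .
    moreover have "limsup (\<lambda>M. ereal (S M)) = \<infinity>"
    proof (rule ereal_top, rule ccontr)
      fix R
      assume "\<not> ereal R \<le> limsup (\<lambda>M. ereal (S M))"
      then have "eventually (\<lambda>M. ereal (S M) < ereal R) sequentially"
        by (intro Limsup_lessD) simp
      then obtain M0 where M0: "\<And>M. M0 \<le> M \<Longrightarrow> S M < R"
        by (auto simp: eventually_sequentially)
      \<comment> \<open>A sum reaching \<open>L\<close> beats all sums up to index
        \<open>M0\<close>, hence comes later, yet is at least \<open>R\<close>.\<close>
      define L where "L = max \<lceil>R\<rceil> (Max (S ` {..M0}) + 1)"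
      obtain M where M: "L \<le> S M" using up by blast
      show False
      proof (cases "M0 \<le> M")
        case True
        then show ?thesis using M0[OF True] M unfolding L_def by linarith
      next
        case False
        then have "S M \<le> Max (S ` {..M0})" by (intro Max_ge) auto
        then show ?thesis using M unfolding L_def by linarith
      qed
    qed
    ultimately show "liminf (\<lambda>N. ereal (real_of_int (\<Sum>i=0..N. f ((rotation \<alpha> ^^ i) x)))) > -\<infinity> \<and>
     limsup (\<lambda>N. ereal (real_of_int (\<Sum>i=0..N. f ((rotation \<alpha> ^^ i) x)))) = \<infinity>"
      unfolding S by simp
  qed
qed

end

section \<open>The golden rotation satisfies the requirements, with even indices for
  \<open>e\<close> and odd ones for \<open>d\<close>\<close>

interpretation golden: interleaved_approximations golden
  "\<lambda>j. den (2 * j)" "\<lambda>j. den (2 * j + 1)"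
  "\<lambda>j. int (fst (golden_convergent ((2 * j + 1)\<^sup>2)))" "\<lambda>j. int (fst (golden_convergent ((2 * j + 1 + 1)\<^sup>2)))"
  "\<lambda>j. err (2 * j)" "\<lambda>j. err (2 * j + 1)"
proof
  have tail: "(\<Sum>j. err (2 * (j + Suc k))) \<le> 2 * err (2 * k + 2)" for k
    using suminf_err_sparse_le[of "2 * k + 2"] by (simp add: algebra_simps)
  have tail_nonneg: "0 \<le> (\<Sum>j. err (2 * (j + Suc k)))" for k
    using summable_err_sparse[of "2 * k + 2"] err_pos
    by (intro suminf_nonneg) (simp_all add: algebra_simps less_imp_le)
  fix j k :: nat
  show "real (den (2 * j)) * golden
      = of_int (int (fst (golden_convergent ((2 * j + 1)\<^sup>2)))) + err (2 * j)"
    by (rule den_golden)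
  show "real (den (2 * j + 1)) * golden
      = of_int (int (fst (golden_convergent ((2 * j + 1 + 1)\<^sup>2)))) + err (2 * j + 1)"
    by (rule den_golden)
  show "0 < err (2 * j)" "0 < err (2 * j + 1)" by (rule err_pos)+
  show "0 < den (2 * j)" by (rule den_pos)
  show "den (2 * j + 1) \<le> den (2 * Suc j)" by (rule den_mono) simp
  show "summable (\<lambda>j. err (2 * j))" using summable_err_sparse[of 0] by simp
  show "summable (\<lambda>j. err (2 * j + 1))" using summable_err_sparse[of 1] by simp
  \<comment> \<open>The tail is at most twice its first term, which is at most a quarter of
    \<open>err (2 * k + 1)\<close>.\<close>
  show "(\<Sum>j. err (2 * (j + Suc k))) < err (2 * k + 1)"
    using tail[of k] err_Suc_le[of "2 * k + 1"] err_pos[of "2 * k + 1"] by simp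
  show "suminf (\<lambda>j. err (2 * j)) + suminf (\<lambda>j. err (2 * j + 1)) \<le> 1"
  proof -
    \<comment> \<open>With \<open>err 0\<close> at most 1/4 and \<open>err 1\<close> at most 1/16,
      the total is at most 2 (1/4 + 1/16) = 5/8.\<close>
    have "(golden * golden) * golden \<le> (2 / 5) * (5 / 8)"
      using golden_bounds by (intro mult_mono) (auto simp: golden_sq)
    then have "err 0 \<le> 1 / 4" unfolding err_def by (simp add: mult_ac)
    then show ?thesis
      using suminf_err_sparse_le[of 0] suminf_err_sparse_le[of 1] err_Suc_le[of 0] by simp
  qed
  show "summable (\<lambda>k. real (\<Sum>j\<le>k. den (2 * j)) * err (2 * k + 1))"
  proof (rule summable_comparison_test')
    show "summable (\<lambda>k. (1 / 2 :: real) ^ k)" by (intro summable_geometric) simp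
    fix k :: nat
    have "(\<Sum>j\<le>k. den (2 * j)) \<le> (\<Sum>j\<le>k. den (2 * k))" by (intro sum_mono den_mono) auto
    then have "real (\<Sum>j\<le>k. den (2 * j)) \<le> real (\<Sum>j\<le>k. den (2 * k))" by (rule of_nat_mono)
    then have "real (\<Sum>j\<le>k. den (2 * j)) * err (2 * k + 1) \<le> (real (Suc k) * real (den (2 * k))) * err (2 * k + 1)"
      using err_pos[of "2 * k + 1"] by (intro mult_right_mono) (simp_all add: algebra_simps)
    also have "\<dots> = real (Suc k) * (real (den (2 * k)) * err (Suc (2 * k)))" by simp
    \<comment> \<open>The factor \<open>Suc k\<close>, counting the summands, is absorbed by a power
      of 2.\<close>
    also have "\<dots> \<le> 2 ^ Suc k * (1 / 4) ^ Suc (2 * k)"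
      using err_pos[of "Suc (2 * k)"] of_nat_less_two_power[of "Suc k", where ?'a = real]
      by (intro mult_mono den_err_le) (auto simp del: power_Suc)
    also have "\<dots> \<le> 2 ^ Suc k * (1 / 4) ^ Suc k" by (intro mult_left_mono power_decreasing) auto
    also have "\<dots> = (1 / 2) ^ Suc k" by (simp flip: power_mult_distrib)
    also have "\<dots> \<le> (1 / 2) ^ k" by simp
    finally show "norm (real (\<Sum>j\<le>k. den (2 * j)) * err (2 * k + 1)) \<le> (1 / 2) ^ k"
      using err_pos[of "2 * k + 1"] by (simp add: abs_mult sum_nonneg)
  qed
  show "summable (\<lambda>k. real (den (2 * k + 1)) * (\<Sum>j. err (2 * (j + Suc k))))"
  proof (rule summable_comparison_test')
    show "summable (\<lambda>k. 2 * (1 / 4 :: real) ^ k)" by (intro summable_mult summable_geometric) simp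
    fix k :: nat
    have "real (den (2 * k + 1)) * (\<Sum>j. err (2 * (j + Suc k))) \<le> real (den (2 * k + 1)) * (2 * err (2 * k + 2))"
      using tail by (intro mult_left_mono) auto
    also have "\<dots> = 2 * (real (den (2 * k + 1)) * err (Suc (2 * k + 1)))" by simp
    also have "\<dots> \<le> 2 * (1 / 4) ^ Suc (2 * k + 1)" by (intro mult_left_mono den_err_le) simp
    also have "\<dots> \<le> 2 * (1 / 4) ^ k" by (intro mult_left_mono power_decreasing) auto
    finally show "norm (real (den (2 * k + 1)) * (\<Sum>j. err (2 * (j + Suc k)))) \<le> 2 * (1 / 4) ^ k"
      using tail_nonneg[of k] by (simp add: abs_mult)
  qed
qed

theorem corollary2:
  "\<exists>(\<alpha>::real) (f :: real \<Rightarrow> int).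
     badly_approximable \<alpha> \<and> \<alpha> \<in> {0<..<1} \<and>
     (\<exists>I J :: real set. is_interval I \<and> is_interval J \<and> I \<subseteq> {0..<1} \<and> J \<subseteq> {0..<1} \<and>
        (\<forall>x\<in>{0..<1}. f x = indicator I x - indicator J x)) \<and>
     (LINT x:{0..<1}|lebesgue. real_of_int (f x)) = 0 \<and>
     (AE x in lebesgue. x \<in> {0..<1} \<longrightarrow>
        liminf (\<lambda>N. ereal (real_of_int (\<Sum>i=0..N. f ((rotation \<alpha> ^^ i) x)))) > -\<infinity> \<and>
        limsup (\<lambda>N. ereal (real_of_int (\<Sum>i=0..N. f ((rotation \<alpha> ^^ i) x)))) = \<infinity>)"
proof (rule exI[of _ golden], rule exI[of _ golden.f], intro conjI)
  show "badly_approximable golden" by (rule badly_approximable_golden)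
  show "golden \<in> {0<..<1}" using golden_bounds by simp
  have "is_interval {0..<golden.\<beta>}" "is_interval {golden.c..<golden.c + golden.\<beta>}"
    by (auto simp: is_interval_1)
  moreover have "{0..<golden.\<beta>} \<subseteq> {0..<1}" "{golden.c..<golden.c + golden.\<beta>} \<subseteq> {0..<1}"
    using golden.\<beta>_c_le golden.c_pos by auto
  ultimately show "\<exists>I J :: real set. is_interval I \<and> is_interval J \<and> I \<subseteq> {0..<1} \<and> J \<subseteq> {0..<1} \<and>
      (\<forall>x\<in>{0..<1}. golden.f x = indicator I x - indicator J x)"
    using golden.f_eq_indicators by blast
qed (rule golden.integral_f, rule golden.limits_f)

end
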